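(* Let $\mathcal{Z}$ be a measurable space, $P$ a probability distribution on $\mathcal{Z}\times\mathcal{Z}$, $\mu$ a $\sigma$-finite base measure on $\mathcal{Z}$, and $Q$ an ensembling channel on $\mathcal{Z}$ such that $Q(\cdot\mid z)$ has a density with respect to $\mu$ for every $z\in\mathcal{Z}$. Then \[\|T_{P,Q}\|_{L_\infty\to L_1}\leq 4\,\mathbb{E}_{(Z,Z')\sim P}\Big[\big(\mathrm{d}_{\mathrm{TV}}(Q(\cdot\mid Z),Q(\cdot\mid Z'))\big)^2\Big],\] where $\mathrm{d}_{\mathrm{TV}}$ denotes the total variation distance.
   Context: An ensembling channel $Q$ is a Markov kernel on $\mathcal{Z}$: for each $z\in\mathcal{Z}$, $Q(\cdot\mid z)$ is a probability distribution on $\mathcal{Z}$. Its density with respect to $\mu$ is also denoted $Q(\cdot\mid z)$, and the map $(w,z)\mapsto Q(w\mid z)$ is taken jointly measurable. The kernel is \[K_{P,Q}(z,z')=\mathbb{E}_{(Z_0,Z_1)\sim P}\big[(Q(z\mid Z_0)-Q(z\mid Z_1))\,(Q(z'\mid Z_0)-Q(z'\mid Z_1))\big],\] and for bounded measurable $f:\mathcal{Z}\to\mathbb{R}$, $[T_{P,Q}f](z)=\int_{\mathcal{Z}}K_{P,Q}(z,z')f(z')\,d\mu(z')$. The operator norm is $\|T_{P,Q}\|_{L_\infty\to L_1}=\sup\{\|T_{P,Q}f\|_{L_1}: f \text{ measurable},\ \|f\|_{L_\infty}\leq 1\}$, where $\|f\|_{L_1}=\int_{\mathcal{Z}}|f(z)|\,d\mu(z)$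 and $\|f\|_{L_\infty}=\sup_{z\in\mathcal{Z}}|f(z)|$. Total variation distance is normalized to lie in $[0,1]$: $\mathrm{d}_{\mathrm{TV}}(P_1,P_2)=\sup_{A\text{ measurable}}|P_1(A)-P_2(A)|$. *)

theory Defs
  imports "HOL-Probability.Probability"
begin

text \<open>
  The base measure \<open>M\<close> also carries the underlying measurable space: \<open>prob_algebra M\<close> is the space of
  probability measures on the sigma-algebra of \<open>M\<close> and does not depend on the values of \<open>M\<close>.
\<close>

definition ensembling_channel :: "'a measure \<Rightarrow> ('a \<Rightarrow> 'a measure) \<Rightarrow> bool" where
  "ensembling_channel M Q \<longleftrightarrow> Q \<in> M \<rightarrow>\<^sub>M prob_algebra M"

text \<open>The value \<open>q w z\<close> stands for \<open>Q(w | z)\<close>: the conditioning point is the second argument.\<close>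

definition channel_density ::
    "'a measure \<Rightarrow> ('a \<Rightarrow> 'a measure) \<Rightarrow> ('a \<Rightarrow> 'a \<Rightarrow> real) \<Rightarrow> bool" where
  "channel_density M Q q \<longleftrightarrow>
     (\<lambda>(w, z). q w z) \<in> borel_measurable (M \<Otimes>\<^sub>M M) \<and>
     (\<forall>w\<in>space M. \<forall>z\<in>space M. 0 \<le> q w z) \<and>
     (\<forall>z\<in>space M. Q z = density M (\<lambda>w. ennreal (q w z)))"

text \<open>
  The integrals in the next two definitions are Bochner integrals, hence \<open>0\<close> where the integrand is
  not integrable. For a jointly measurable channel density and bounded measurable \<open>f\<close> this concerns
  only null sets, because \<open>q\<close> has integral \<open>1\<close> in its first argument.
\<close>

definition ens_kernel ::
    "('a \<times> 'a) measure \<Rightarrow> ('a \<Rightarrow> 'a \<Rightarrow> real) \<Rightarrow> 'a \<Rightarrow> 'a \<Rightarrow> real" where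
  "ens_kernel P q z z' =
     (\<integral>p. (q z (fst p) - q z (snd p)) * (q z' (fst p) - q z' (snd p)) \<partial>P)"

definition ens_operator ::
    "'a measure \<Rightarrow> ('a \<times> 'a) measure \<Rightarrow> ('a \<Rightarrow> 'a \<Rightarrow> real) \<Rightarrow> ('a \<Rightarrow> real) \<Rightarrow> 'a \<Rightarrow> real" where
  "ens_operator M P q f z = (\<integral>z'. ens_kernel P q z z' * f z' \<partial>M)"

text \<open>
  The norms take values in \<open>ennreal\<close>, so that suprema and integrals that are infinite in the
  mathematical sense really are \<open>\<infinity>\<close>. The norm \<open>Linf_norm\<close> is the pointwise, not the essential,
  supremum.
\<close>

definition Linf_norm :: "'a measure \<Rightarrow> ('a \<Rightarrow> real) \<Rightarrow> ennreal" where
  "Linf_norm M f = (\<Squnion>z\<in>space M. ennreal \<bar>f z\<bar>)"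

definition L1_norm :: "'a measure \<Rightarrow> ('a \<Rightarrow> real) \<Rightarrow> ennreal" where
  "L1_norm M f = (\<integral>\<^sup>+z. ennreal \<bar>f z\<bar> \<partial>M)"

definition Linf_L1_norm :: "'a measure \<Rightarrow> (('a \<Rightarrow> real) \<Rightarrow> 'a \<Rightarrow> real) \<Rightarrow> ennreal" where
  "Linf_L1_norm M T = (\<Squnion>f\<in>{f \<in> borel_measurable M. Linf_norm M f \<le> 1}. L1_norm M (T f))"

text \<open>Meant for probability measures with the same measurable sets, where the supremum is over a
  nonempty set of reals bounded by \<open>1\<close>.\<close>

definition tv_dist :: "'a measure \<Rightarrow> 'a measure \<Rightarrow> real" where
  "tv_dist P1 P2 = (\<Squnion>A\<in>sets P1. \<bar>measure P1 A - measure P2 A\<bar>)"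

end

theory Submission
  imports Defs
begin

text \<open>
  For \<open>p = (z\<^sub>0, z\<^sub>1)\<close> write \<open>d\<^sub>p(w) = Q(w | z\<^sub>0) - Q(w | z\<^sub>1)\<close>. If \<open>\<bar>f\<bar> \<le> 1\<close>, the triangle inequality
  for integrals bounds \<open>\<bar>T f (z)\<bar>\<close> by \<open>\<integral>\<integral> \<bar>d\<^sub>p(z)\<bar> \<bar>d\<^sub>p(z')\<bar> dP(p) d\<mu>(z')\<close>. Integrating over \<open>z\<close> and
  moving the integral over \<open>p\<close> outside by Tonelli's theorem gives \<open>\<integral> (\<integral> \<bar>d\<^sub>p\<bar> d\<mu>)\<^sup>2 dP(p)\<close>. The inner
  integral is twice a total variation distance by Scheffe's identity, proved as
  \<open>tv_dist_density_eq\<close>, and this yields the factor \<open>4\<close>.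
\<close>

lemma measure_density_eq_set_integral:
  fixes f :: "'a \<Rightarrow> real"
  assumes "integrable M f" and "\<And>x. x \<in> space M \<Longrightarrow> 0 \<le> f x" and A: "A \<in> sets M"
  shows "measure (density M (\<lambda>x. ennreal (f x))) A = (\<integral>x. indicator A x * f x \<partial>M)"
proof -
  have [measurable]: "f \<in> borel_measurable M" "A \<in> sets M"
    using assms by auto
  have "emeasure (density M (\<lambda>x. ennreal (f x))) A = (\<integral>\<^sup>+x. ennreal (indicator A x * f x) \<partial>M)"
    by (subst emeasure_density)
       (auto intro!: nn_integral_cong simp: indicator_def)
  also have "\<dots> = ennreal (\<integral>x. indicator A x * f x \<partial>M)"
    using integrable_mult_indicator[OF A assms(1)] assms(2)
    by (intro nn_integral_eq_integral) auto
  finally show ?thesis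
    using assms(2) by (simp add: measure_def integral_nonneg_AE)
qed

text \<open>
  Scheffe's identity: for densities with the same total mass, the total variation distance is half
  of the \<open>L\<^sub>1\<close> distance. The supremum is attained at the set where the first density dominates.
\<close>

lemma tv_dist_density_eq:
  fixes f g :: "'a \<Rightarrow> real"
  assumes f: "integrable M f" and g: "integrable M g"
    and f0: "\<And>x. x \<in> space M \<Longrightarrow> 0 \<le> f x" and g0: "\<And>x. x \<in> space M \<Longrightarrow> 0 \<le> g x"
    and eq: "(\<integral>x. f x \<partial>M) = (\<integral>x. g x \<partial>M)"
  shows "tv_dist (density M (\<lambda>x. ennreal (f x))) (density M (\<lambda>x. ennreal (g x)))
           = (\<integral>x. \<bar>f x - g x\<bar> \<partial>M) / 2"
proof -
  have [measurable]: "f \<in> borel_measurable M" "g \<in> borel_measurable M"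
    using f g by auto
  let ?P = "density M (\<lambda>x. ennreal (f x))" and ?R = "density M (\<lambda>x. ennreal (g x))"
  have int: "integrable M (\<lambda>x. f x - g x)"
    using f g by simp
  have int_ind: "integrable M (\<lambda>x. indicator A x * h x)"
    if "integrable M h" "A \<in> sets M" for A and h :: "'a \<Rightarrow> real"
    using integrable_mult_indicator[OF that(2,1)] by simp
  have diff: "measure ?P A - measure ?R A = (\<integral>x. indicator A x * (f x - g x) \<partial>M)"
    if "A \<in> sets M" for A
    using that f g f0 g0
    by (simp add: measure_density_eq_set_integral int_ind right_diff_distrib)
  \<comment> \<open>As \<open>f - g\<close> has integral \<open>0\<close>, its integral over \<open>A\<close> is half of its integral against the sign
    function that is \<open>1\<close> on \<open>A\<close> and \<open>-1\<close> elsewhere.\<close>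
  have twice: "2 * (measure ?P A - measure ?R A)
      = (\<integral>x. (2 * indicator A x - 1) * (f x - g x) \<partial>M)" if A: "A \<in> sets M" for A
  proof -
    have "(\<integral>x. (2 * indicator A x - 1) * (f x - g x) \<partial>M)
        = (\<integral>x. 2 * (indicator A x * (f x - g x)) - (f x - g x) \<partial>M)"
      by (rule Bochner_Integration.integral_cong) (auto simp: algebra_simps)
    also have "\<dots> = 2 * (\<integral>x. indicator A x * (f x - g x) \<partial>M) - (\<integral>x. f x - g x \<partial>M)"
      using int_ind[OF int A] int by (subst Bochner_Integration.integral_diff) auto
    also have "(\<integral>x. f x - g x \<partial>M) = 0"
      using f g eq by simp
    finally show ?thesis
      using diff[OF A] by simp
  qed
  have upper: "\<bar>measure ?P A - measure ?R A\<bar> \<le> (\<integral>x. \<bar>f x - g x\<bar> \<partial>M) / 2" if "A \<in> sets M" for A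
  proof -
    have "\<bar>\<integral>x. (2 * indicator A x - 1) * (f x - g x) \<partial>M\<bar>
        \<le> (\<integral>x. \<bar>(2 * indicator A x - 1) * (f x - g x)\<bar> \<partial>M)"
      by (rule integral_abs_bound)
    also have "\<dots> = (\<integral>x. \<bar>f x - g x\<bar> \<partial>M)"
      by (rule Bochner_Integration.integral_cong) (auto simp: indicator_def)
    finally show ?thesis
      unfolding twice[OF that, symmetric] abs_mult by simp
  qed
  define B where "B = {x \<in> space M. g x \<le> f x}"
  have B: "B \<in> sets M"
    unfolding B_def by measurable
  have "(\<integral>x. (2 * indicator B x - 1) * (f x - g x) \<partial>M) = (\<integral>x. \<bar>f x - g x\<bar> \<partial>M)"
    by (rule Bochner_Integration.integral_cong) (auto simp: B_def indicator_def)
  with twice[OF B] have "(\<integral>x. \<bar>f x - g x\<bar> \<partial>M) / 2 = measure ?P B - measure ?R B"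
    by simp
  then have attained: "(\<integral>x. \<bar>f x - g x\<bar> \<partial>M) / 2 \<le> \<bar>measure ?P B - measure ?R B\<bar>"
    by (simp only: abs_ge_self)
  show ?thesis
    unfolding tv_dist_def
  proof (rule antisym)
    show "(\<Squnion>A\<in>sets ?P. \<bar>measure ?P A - measure ?R A\<bar>) \<le> (\<integral>x. \<bar>f x - g x\<bar> \<partial>M) / 2"
      using upper by (intro cSUP_least) auto
    have "bdd_above ((\<lambda>A. \<bar>measure ?P A - measure ?R A\<bar>) ` sets ?P)"
      using upper by (intro bdd_aboveI2[where M = "(\<integral>x. \<bar>f x - g x\<bar> \<partial>M) / 2"]) auto
    then show "(\<integral>x. \<bar>f x - g x\<bar> \<partial>M) / 2 \<le> (\<Squnion>A\<in>sets ?P. \<bar>measure ?P A - measure ?R A\<bar>)"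
      using attained B by (intro cSUP_upper2[where x = B]) auto
  qed
qed

text \<open>
  No integrability is needed: a Bochner integral of a non-integrable function is \<open>0\<close>. For this reason
  the points where the kernel or the operator is not defined classically need no separate treatment.
\<close>

lemma ennreal_abs_integral_le:
  fixes h :: "'a \<Rightarrow> real"
  shows "ennreal \<bar>\<integral>x. h x \<partial>M\<bar> \<le> (\<integral>\<^sup>+x. ennreal \<bar>h x\<bar> \<partial>M)"
  using integral_norm_bound_ennreal[of M h]
  by (cases "integrable M h") (auto simp: not_integrable_integral_eq)

text \<open>
  The analytic core: two applications of Tonelli's theorem, with no integrability condition on \<open>q\<close>.
  The right-hand side is the expected square of the \<open>L\<^sub>1\<close> norm of \<open>d\<^sub>p\<close>.
\<close>

lemma L1_norm_ens_operator_le: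
  assumes "sigma_finite_measure M" and "sigma_finite_measure P"
    and q: "(\<lambda>(w, z). q w z) \<in> borel_measurable (M \<Otimes>\<^sub>M M)"
    and sets_P: "sets P = sets (M \<Otimes>\<^sub>M M)"
    and f: "Linf_norm M f \<le> 1"
  shows "L1_norm M (ens_operator M P q f)
           \<le> (\<integral>\<^sup>+p. (\<integral>\<^sup>+z. ennreal \<bar>q z (fst p) - q z (snd p)\<bar> \<partial>M)\<^sup>2 \<partial>P)"
proof -
  interpret M: sigma_finite_measure M by fact
  interpret P: sigma_finite_measure P by fact
  interpret PM: pair_sigma_finite P M ..
  define a where "a p z = ennreal \<bar>q z (fst p) - q z (snd p)\<bar>" for p :: "'a \<times> 'a" and z
  define N where "N p = (\<integral>\<^sup>+z. a p z \<partial>M)" for p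
  have fst_P: "fst \<in> P \<rightarrow>\<^sub>M M" and snd_P: "snd \<in> P \<rightarrow>\<^sub>M M"
    by (simp_all add: measurable_cong_sets[OF sets_P refl])
  have q_comp: "(\<lambda>x. q (u x) (v x)) \<in> borel_measurable K"
    if "u \<in> K \<rightarrow>\<^sub>M M" "v \<in> K \<rightarrow>\<^sub>M M" for u v and K :: "('b \<times> 'c) measure"
    using measurable_compose[OF measurable_Pair[OF that] q] by simp
  have a_meas [measurable]: "(\<lambda>(p, z). a p z) \<in> borel_measurable (P \<Otimes>\<^sub>M M)"
    unfolding a_def split_beta
    by (intro measurable_compose[OF _ measurable_ennreal] borel_measurable_abs
        borel_measurable_diff q_comp measurable_snd
        measurable_compose[OF measurable_fst fst_P] measurable_compose[OF measurable_fst snd_P])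
  have N_meas [measurable]: "N \<in> borel_measurable P"
    unfolding N_def by measurable
  have f1: "ennreal \<bar>f z\<bar> \<le> 1" if "z \<in> space M" for z
    using f that unfolding Linf_norm_def by (auto simp: SUP_le_iff)
  have kernel: "ennreal \<bar>ens_kernel P q z z'\<bar> \<le> (\<integral>\<^sup>+p. a p z * a p z' \<partial>P)" for z z'
    using ennreal_abs_integral_le[of P "\<lambda>p. (q z (fst p) - q z (snd p)) * (q z' (fst p) - q z' (snd p))"]
    by (simp add: ens_kernel_def a_def abs_mult ennreal_mult)
  have pointwise: "ennreal \<bar>ens_operator M P q f z\<bar> \<le> (\<integral>\<^sup>+p. a p z * N p \<partial>P)"
    if [measurable]: "z \<in> space M" for z
  proof -
    have "ennreal \<bar>ens_operator M P q f z\<bar> \<le> (\<integral>\<^sup>+z'. ennreal \<bar>ens_kernel P q z z' * f z'\<bar> \<partial>M)"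
      unfolding ens_operator_def by (rule ennreal_abs_integral_le)
    also have "\<dots> \<le> (\<integral>\<^sup>+z'. (\<integral>\<^sup>+p. a p z * a p z' \<partial>P) \<partial>M)"
    proof (rule nn_integral_mono)
      fix z' assume "z' \<in> space M"
      then show "ennreal \<bar>ens_kernel P q z z' * f z'\<bar> \<le> (\<integral>\<^sup>+p. a p z * a p z' \<partial>P)"
        using mult_mono[OF kernel[of z z'] f1[of z']] by (simp add: abs_mult ennreal_mult)
    qed
    also have "\<dots> = (\<integral>\<^sup>+p. (\<integral>\<^sup>+z'. a p z * a p z' \<partial>M) \<partial>P)"
      by (rule PM.Fubini') measurable
    also have "\<dots> = (\<integral>\<^sup>+p. a p z * N p \<partial>P)"
      unfolding N_def by (intro nn_integral_cong nn_integral_cmult) measurable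
    finally show ?thesis .
  qed
  have "L1_norm M (ens_operator M P q f) \<le> (\<integral>\<^sup>+z. (\<integral>\<^sup>+p. a p z * N p \<partial>P) \<partial>M)"
    unfolding L1_norm_def by (intro nn_integral_mono pointwise)
  also have "\<dots> = (\<integral>\<^sup>+p. (\<integral>\<^sup>+z. a p z * N p \<partial>M) \<partial>P)"
    by (rule PM.Fubini') measurable
  also have "\<dots> = (\<integral>\<^sup>+p. (N p)\<^sup>2 \<partial>P)"
  proof (rule nn_integral_cong)
    fix p assume [measurable]: "p \<in> space P"
    show "(\<integral>\<^sup>+z. a p z * N p \<partial>M) = (N p)\<^sup>2"
      by (subst nn_integral_multc) (auto simp: N_def power2_eq_square)
  qed
  finally show ?thesis
    unfolding N_def a_def .
qed

theorem proposition8: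
  fixes \<mu> :: "'a measure"
    and P :: "('a \<times> 'a) measure"
    and Q :: "'a \<Rightarrow> 'a measure"
    and q :: "'a \<Rightarrow> 'a \<Rightarrow> real"
  assumes "sigma_finite_measure \<mu>"
    and "prob_space P" and "sets P = sets (\<mu> \<Otimes>\<^sub>M \<mu>)"
    and "ensembling_channel \<mu> Q"
    and "channel_density \<mu> Q q"
  shows "Linf_L1_norm \<mu> (ens_operator \<mu> P q)
           \<le> ennreal (4 * (\<integral>p. (tv_dist (Q (fst p)) (Q (snd p)))\<^sup>2 \<partial>P))"
proof -
  interpret \<mu>: sigma_finite_measure \<mu> by fact
  interpret P: prob_space P by fact
  have q: "(\<lambda>(w, z). q w z) \<in> borel_measurable (\<mu> \<Otimes>\<^sub>M \<mu>)"
    and q0: "\<And>w z. w \<in> space \<mu> \<Longrightarrow> z \<in> space \<mu> \<Longrightarrow> 0 \<le> q w z"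
    and Q: "\<And>z. z \<in> space \<mu> \<Longrightarrow> Q z = density \<mu> (\<lambda>w. ennreal (q w z))"
    using assms(5) by (auto simp: channel_density_def)
  have space_P: "space P = space \<mu> \<times> space \<mu>"
    using sets_eq_imp_space_eq[OF assms(3)] by (simp add: space_pair_measure)
  have q_meas: "(\<lambda>w. q w z) \<in> borel_measurable \<mu>" if "z \<in> space \<mu>" for z
    using measurable_compose[OF measurable_Pair2'[OF that] q] by simp
  have mass: "(\<integral>\<^sup>+w. ennreal (q w z) \<partial>\<mu>) = 1" if z: "z \<in> space \<mu>" for z
  proof -
    interpret Qz: prob_space "Q z"
      using measurable_space[OF assms(4)[unfolded ensembling_channel_def] z]
      by (simp add: space_prob_algebra)
    have "emeasure (Q z) (space \<mu>) = 1"
      using Qz.emeasure_space_1 Q[OF z] by simp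
    then show ?thesis
      using q_meas[OF z] unfolding Q[OF z]
      by (simp add: emeasure_density cong: nn_integral_cong)
  qed
  have q_int: "integrable \<mu> (\<lambda>w. q w z)" and q_integral: "(\<integral>w. q w z \<partial>\<mu>) = 1"
    if z: "z \<in> space \<mu>" for z
  proof -
    show "integrable \<mu> (\<lambda>w. q w z)"
      using q_meas[OF z] q0 z mass[OF z]
      by (intro integrableI_nonneg) (auto intro: AE_I2)
    show "(\<integral>w. q w z \<partial>\<mu>) = 1"
      using q_meas[OF z] q0 z mass[OF z]
      by (subst integral_eq_nn_integral) (auto intro: AE_I2)
  qed

  define t where "t p = tv_dist (Q (fst p)) (Q (snd p))" for p
  have t_eq: "t p = (\<integral>w. \<bar>q w (fst p) - q w (snd p)\<bar> \<partial>\<mu>) / 2" if p: "p \<in> space P" for p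
    using p tv_dist_density_eq[of \<mu> "\<lambda>w. q w (fst p)" "\<lambda>w. q w (snd p)"]
    by (auto simp: space_P t_def Q q0 q_int q_integral)
  have t0: "0 \<le> t p" if "p \<in> space P" for p
    unfolding t_eq[OF that] by simp
  have t_nn: "(\<integral>\<^sup>+w. ennreal \<bar>q w (fst p) - q w (snd p)\<bar> \<partial>\<mu>) = ennreal (2 * t p)"
    if p: "p \<in> space P" for p
    using p t_eq[OF p] t0[OF p]
    by (subst nn_integral_eq_integral) (auto simp: space_P q_int mult.commute)
  have t1: "t p \<le> 1" if p: "p \<in> space P" for p
  proof -
    have fp: "fst p \<in> space \<mu>" "snd p \<in> space \<mu>"
      using p unfolding space_P by auto
    have "(\<integral>w. \<bar>q w (fst p) - q w (snd p)\<bar> \<partial>\<mu>) \<le> (\<integral>w. q w (fst p) + q w (snd p) \<partial>\<mu>)"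
    proof (rule integral_mono)
      fix w assume "w \<in> space \<mu>"
      then show "\<bar>q w (fst p) - q w (snd p)\<bar> \<le> q w (fst p) + q w (snd p)"
        using q0[of w "fst p"] q0[of w "snd p"] fp by linarith
    qed (use fp q_int in auto)
    also have "\<dots> = 2"
      using fp by (simp add: q_int q_integral)
    finally show ?thesis
      using t_eq[OF p] by simp
  qed
  have t_meas: "t \<in> borel_measurable P"
  proof -
    have "(\<lambda>(p, w). \<bar>q w (fst p) - q w (snd p)\<bar>) \<in> borel_measurable ((\<mu> \<Otimes>\<^sub>M \<mu>) \<Otimes>\<^sub>M \<mu>)"
      using measurable_compose[OF _ q, of "\<lambda>(p, w). (w, fst p)" "(\<mu> \<Otimes>\<^sub>M \<mu>) \<Otimes>\<^sub>M \<mu>"]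
        measurable_compose[OF _ q, of "\<lambda>(p, w). (w, snd p)" "(\<mu> \<Otimes>\<^sub>M \<mu>) \<Otimes>\<^sub>M \<mu>"]
      by (simp add: split_beta)
    then have "(\<lambda>p. \<integral>w. \<bar>q w (fst p) - q w (snd p)\<bar> \<partial>\<mu>) \<in> borel_measurable (\<mu> \<Otimes>\<^sub>M \<mu>)"
      by (rule \<mu>.borel_measurable_lebesgue_integral)
    then have "(\<lambda>p. (\<integral>w. \<bar>q w (fst p) - q w (snd p)\<bar> \<partial>\<mu>) / 2) \<in> borel_measurable P"
      by (simp add: measurable_cong_sets[OF assms(3) refl])
    then show ?thesis
      by (simp add: t_eq cong: measurable_cong)
  qed
  \<comment> \<open>Boundedness and measurability make the Bochner integral on the right-hand side the true
    expectation rather than the default value \<open>0\<close>.\<close>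
  have "integrable P (\<lambda>p. (t p)\<^sup>2)"
    using t_meas t0 t1
    by (intro P.integrable_const_bound[of _ 1] AE_I2) (auto simp: power_le_one)
  then have "(\<integral>\<^sup>+p. ennreal (4 * (t p)\<^sup>2) \<partial>P) = ennreal (4 * (\<integral>p. (t p)\<^sup>2 \<partial>P))"
    by (subst nn_integral_eq_integral) auto
  moreover have "(\<integral>\<^sup>+p. (\<integral>\<^sup>+z. ennreal \<bar>q z (fst p) - q z (snd p)\<bar> \<partial>\<mu>)\<^sup>2 \<partial>P)
      = (\<integral>\<^sup>+p. ennreal (4 * (t p)\<^sup>2) \<partial>P)"
    by (rule nn_integral_cong) (simp add: t_nn t0 ennreal_power power_mult_distrib)
  ultimately have "L1_norm \<mu> (ens_operator \<mu> P q f) \<le> ennreal (4 * (\<integral>p. (t p)\<^sup>2 \<partial>P))"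
    if "Linf_norm \<mu> f \<le> 1" for f
    using L1_norm_ens_operator_le[OF assms(1) P.sigma_finite_measure_axioms q assms(3) that] by simp
  then show ?thesis
    unfolding Linf_L1_norm_def t_def by (auto intro!: SUP_least)
qed

end
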